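(* Let $(X,\neg,\preceq)$ be a tuple in class $\mathcal{C}$ and let $P,Q\in X$. Suppose that either $Q\preceq\neg Q$ or $\neg Q\preceq Q$, and that there exists $0\in Z$ such that $P\succ 0$. Let $|Q|=\max(\{Q,\neg Q\})$ and consider the six statements $$A:\ P\preceq Q,\quad E:\ P\preceq \neg Q,\quad I:\ P\not\preceq \neg Q,\quad O:\ P\not\preceq Q,\quad U:\ P\preceq |Q|,\quad Y:\ P\not\preceq |Q|.$$ Then: \begin{itemize} \item $A\Rightarrow I$. \item $E\Rightarrow O$. \item $A$ and $E$ cannot both be true. \item $I$ and $O$ cannot both be false. \item $A$ is equivalent to the negation of $O$. \item $E$ is equivalent to the negation of $I$. \item $A\Rightarrow U$ and $E\Rightarrow U$. \item $Y\Rightarrow I$ and $Y\Rightarrow O$. \item $A$ and $Y$ cannot both be true. \item $E$ and $Y$ cannot both be true. \item $I$ and $U$ cannot both be false. \item $O$ and $U$ cannot both be false. \end{itemize}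
   Context: A tuple $(X,\neg,\preceq)$ is in class $\mathcal{C}$ if: (i) $\neg:X\to X$ is an involutory unary operation on the set $X$, i.e. $\neg(\neg(x))=x$ for all $x\in X$; (ii) $\preceq$ is a (reflexive, antisymmetric, transitive) partial order on $X$; (iii) for all $a,b\in X$, $a\preceq b$ if and only if $\neg b\preceq\neg a$; (iv) there exists an element $0\in X$ such that $\neg 0\preceq 0$. The (nonempty) set of zeros is $Z=\{x\in X:\neg x\preceq x\}$; the symbol $0$ denotes an element of $Z$ (not necessarily unique). $P\prec Q$ means $P\preceq Q$ and $P\neq Q$; $P\succ Q$ means $Q\prec P$; $P\not\preceq Q$ is the negation of $P\preceq Q$. For a subset $S\subseteq X$, $\max(S)$ is the element $y\in S$ with $z\preceq y$ for all $z\in S$. When $Q\preceq\neg Q$ or $\neg Q\preceq Q$, the element $|Q|=\max(\{Q,\neg Q\})$ exists and is unique (it is $\neg Q$ if $Q\preceq\neg Q$, and $Q$ if $\neg Q\preceq Q$). *)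

theory Defs
  imports Main
begin

text \<open>The order is a predicate that only matters on the carrier \<open>X\<close>; its values outside
  \<open>X\<close> are unconstrained.\<close>

locale class_C =
  fixes X :: "'a set"
    and neg :: "'a \<Rightarrow> 'a"
    and le :: "'a \<Rightarrow> 'a \<Rightarrow> bool"
  assumes neg_closed: "x \<in> X \<Longrightarrow> neg x \<in> X"
    and neg_neg: "x \<in> X \<Longrightarrow> neg (neg x) = x"
    and le_refl: "reflp_on X le"
    and le_antisym: "antisymp_on X le"
    and le_trans: "transp_on X le"
    and le_neg_iff: "a \<in> X \<Longrightarrow> b \<in> X \<Longrightarrow> le a b \<longleftrightarrow> le (neg b) (neg a)"
    and ex_zero: "\<exists>z\<in>X. le (neg z) z"

definition zeros :: "'a set \<Rightarrow> ('a \<Rightarrow> 'a) \<Rightarrow> ('a \<Rightarrow> 'a \<Rightarrow> bool) \<Rightarrow> 'a set" where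
  "zeros X neg le = {x \<in> X. le (neg x) x}"

definition strict :: "('a \<Rightarrow> 'a \<Rightarrow> bool) \<Rightarrow> 'a \<Rightarrow> 'a \<Rightarrow> bool" where
  "strict le x y \<longleftrightarrow> le x y \<and> x \<noteq> y"

text \<open>The definite description is unspecified when \<open>S\<close> has no greatest element.\<close>

definition max_of :: "('a \<Rightarrow> 'a \<Rightarrow> bool) \<Rightarrow> 'a set \<Rightarrow> 'a" where
  "max_of le S = (THE y. y \<in> S \<and> (\<forall>z\<in>S. le z y))"

definition absv :: "('a \<Rightarrow> 'a) \<Rightarrow> ('a \<Rightarrow> 'a \<Rightarrow> bool) \<Rightarrow> 'a \<Rightarrow> 'a" where
  "absv neg le Q = max_of le {Q, neg Q}"

text \<open>The description denotes the intended element in both comparable cases.\<close>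

lemma (in class_C) max_of_eqI:
  assumes "S \<subseteq> X" "y \<in> S" "\<And>z. z \<in> S \<Longrightarrow> le z y"
  shows "max_of le S = y"
  unfolding max_of_def
proof (rule the_equality)
  show "y \<in> S \<and> (\<forall>z\<in>S. le z y)" using assms by blast
next
  fix w assume "w \<in> S \<and> (\<forall>z\<in>S. le z w)"
  then show "w = y" using assms antisymp_onD[OF le_antisym, of w y] by blast
qed

lemma (in class_C) absv_eq_neg:
  assumes "Q \<in> X" "le Q (neg Q)"
  shows "absv neg le Q = neg Q"
  unfolding absv_def
  by (rule max_of_eqI) (use assms neg_closed reflp_onD[OF le_refl] in auto)

lemma (in class_C) absv_eq_self:
  assumes "Q \<in> X" "le (neg Q) Q"
  shows "absv neg le Q = Q"
  unfolding absv_def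
  by (rule max_of_eqI) (use assms neg_closed reflp_onD[OF le_refl] in auto)

end

theory Submission
  imports Defs
begin

text \<open>Everything rests on two facts about the order. Negation reverses it, so an element below
  both \<open>Q\<close> and \<open>neg Q\<close> lies below its own negation; and a \<open>P\<close> strictly above a zero cannot do
  so, since \<open>P \<preceq> neg P \<preceq> neg z \<preceq> z\<close> would collapse \<open>P\<close> onto \<open>z\<close>. Hence \<open>A\<close> and \<open>E\<close>
  are contrary (\<open>common_lower_bound_le_neg\<close>, \<open>above_zero_not_le_neg\<close>). On the other hand \<open>|Q|\<close>
  is an upper bound of \<open>Q\<close> and \<open>neg Q\<close> (\<open>le_absv\<close>), so each of \<open>A\<close> and \<open>E\<close> implies \<open>U\<close>. As
  \<open>O\<close>, \<open>I\<close>, \<open>Y\<close> are the negations of \<open>A\<close>, \<open>E\<close>, \<open>U\<close>, the whole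
  hexagon follows propositionally from these.\<close>

context class_C
begin

text \<open>Negating \<open>P \<preceq> neg Q\<close> gives \<open>Q \<preceq> neg P\<close>, so \<open>Q\<close> lies between \<open>P\<close> and \<open>neg P\<close>.\<close>

lemma common_lower_bound_le_neg:
  assumes "P \<in> X" "Q \<in> X" "le P Q" "le P (neg Q)"
  shows "le P (neg P)"
proof -
  have "le Q (neg P)"
    using le_neg_iff[of P "neg Q"] assms neg_closed neg_neg by simp
  then show ?thesis
    using transp_onD[OF le_trans, of P Q "neg P"] assms neg_closed by blast
qed

text \<open>Strictness is essential: a zero fixed by negation does lie below its own negation.\<close>

lemma above_zero_not_le_neg:
  assumes "P \<in> X" "z \<in> zeros X neg le" "strict le z P"
  shows "\<not> le P (neg P)"
proof
  assume P: "le P (neg P)"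
  have z: "z \<in> X" "le (neg z) z" and zP: "le z P" "z \<noteq> P"
    using assms by (auto simp: zeros_def strict_def)
  have "le (neg P) (neg z)"
    using le_neg_iff[of z P] z zP assms(1) by blast
  with P have "le P (neg z)"
    using transp_onD[OF le_trans, of P "neg P" "neg z"] z(1) assms(1) neg_closed by blast
  with z have "le P z"
    using transp_onD[OF le_trans, of P "neg z" z] assms(1) neg_closed by blast
  then show False
    using antisymp_onD[OF le_antisym, of z P] z(1) zP assms(1) by blast
qed

lemma le_absv:
  assumes "Q \<in> X" "le Q (neg Q) \<or> le (neg Q) Q"
  shows "le Q (absv neg le Q)" and "le (neg Q) (absv neg le Q)"
  using assms absv_eq_neg absv_eq_self neg_closed reflp_onD[OF le_refl] by metis+

lemma absv_closed:
  assumes "Q \<in> X" "le Q (neg Q) \<or> le (neg Q) Q"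
  shows "absv neg le Q \<in> X"
  using assms absv_eq_neg absv_eq_self neg_closed by metis

end

theorem theorem3:
  fixes X :: "'a set"
    and neg :: "'a \<Rightarrow> 'a"
    and le :: "'a \<Rightarrow> 'a \<Rightarrow> bool"  (infix "\<preceq>" 50)
    and P Q :: 'a
  assumes "class_C X neg (\<preceq>)"
    and "P \<in> X" and "Q \<in> X"
    and "Q \<preceq> neg Q \<or> neg Q \<preceq> Q"
    and "\<exists>z \<in> zeros X neg (\<preceq>). strict (\<preceq>) z P"
  shows "let sA = (P \<preceq> Q);
             sE = (P \<preceq> neg Q);
             sI = (\<not> P \<preceq> neg Q);
             sO = (\<not> P \<preceq> Q);
             sU = (P \<preceq> absv neg (\<preceq>) Q);
             sY = (\<not> P \<preceq> absv neg (\<preceq>) Q)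
         in (sA \<longrightarrow> sI)
          \<and> (sE \<longrightarrow> sO)
          \<and> \<not> (sA \<and> sE)
          \<and> \<not> (\<not> sI \<and> \<not> sO)
          \<and> (sA \<longleftrightarrow> \<not> sO)
          \<and> (sE \<longleftrightarrow> \<not> sI)
          \<and> ((sA \<longrightarrow> sU) \<and> (sE \<longrightarrow> sU))
          \<and> ((sY \<longrightarrow> sI) \<and> (sY \<longrightarrow> sO))
          \<and> \<not> (sA \<and> sY)
          \<and> \<not> (sE \<and> sY)
          \<and> \<not> (\<not> sI \<and> \<not> sU)
          \<and> \<not> (\<not> sO \<and> \<not> sU)"
proof -
  interpret class_C X neg le by (fact assms(1))
  have contrary: "\<not> (P \<preceq> Q \<and> P \<preceq> neg Q)"
    using common_lower_bound_le_neg above_zero_not_le_neg assms(2,3,5) by blast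
  have below_absv: "P \<preceq> absv neg le Q" if "P \<preceq> R" "R \<in> {Q, neg Q}" for R
    using that transp_onD[OF le_trans, of P R "absv neg le Q"] le_absv absv_closed
      neg_closed assms(2-4) by blast
  have "P \<preceq> Q \<longrightarrow> P \<preceq> absv neg le Q" "P \<preceq> neg Q \<longrightarrow> P \<preceq> absv neg le Q"
    using below_absv by blast+
  with contrary show ?thesis
    unfolding Let_def by blast
qed

end
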